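(* Let $G$ be an Eulerian digraph with $n$ vertices and $m$ arcs. Then $\beta(G) \ge \frac{m^2}{2n^2} + \frac{m}{2n}$.
   Context: All digraphs are finite and simple: no loops and no multiple arcs, but two arcs in opposite directions $(u,v)$ and $(v,u)$ between the same pair of vertices are allowed. A digraph is Eulerian if every vertex has in-degree equal to its out-degree. A feedback arc set of a digraph is a set of arcs whose removal leaves a digraph with no directed cycle; $\beta(G)$ denotes the minimum size of a feedback arc set of $G$. *)

theory Defs
  imports Complex_Main "Graph_Theory.Arc_Walk"
begin

text \<open>
  The library locale \<^locale>\<open>digraph\<close> is that of finite digraphs without loops and without parallel
  arcs; a pair of opposite arcs is permitted and counts as a directed cycle.
\<close>

definition eulerian :: "('a, 'b) pre_digraph \<Rightarrow> bool" where
  "eulerian G \<longleftrightarrow> (\<forall>v \<in> verts G. in_degree G v = out_degree G v)"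

definition del_arcs :: "('a, 'b) pre_digraph \<Rightarrow> 'b set \<Rightarrow> ('a, 'b) pre_digraph" where
  "del_arcs G F = \<lparr>verts = verts G, arcs = arcs G - F, tail = tail G, head = head G\<rparr>"

definition feedback_arc_set :: "('a, 'b) pre_digraph \<Rightarrow> 'b set \<Rightarrow> bool" where
  "feedback_arc_set G F \<longleftrightarrow>
     F \<subseteq> arcs G \<and> \<not> (\<exists>p. pre_digraph.cycle (del_arcs G F) p)"

text \<open>
  The set under \<^const>\<open>Min\<close> is finite and nonempty for every finite digraph, since the set of all
  arcs is a feedback arc set.
\<close>

definition min_feedback :: "('a, 'b) pre_digraph \<Rightarrow> nat" (\<open>\<beta>\<close>) where
  "\<beta> G = Min (card ` {F. feedback_arc_set G F})"

end

theory Submission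
  imports Defs
begin

text \<open>
  Number the vertices by \<open>0, \<dots>, n - 1\<close> so that every arc outside a minimum feedback arc set goes
  forward, and place them in this order on a circle. Let the cyclic length of an arc from position
  \<open>i\<close> to position \<open>j\<close> be the representative of \<open>j - i\<close> modulo \<open>n\<close> in \<open>{1, \<dots>, n - 1}\<close>. In an Eulerian
  digraph the differences \<open>j - i\<close> sum to zero, so the cyclic lengths sum to \<open>n\<close> times the number of
  backward arcs, which is at most \<open>n \<cdot> \<beta>\<close>. On the other hand each cyclic length is attained by at
  most \<open>n\<close> arcs, so \<open>m\<close> arcs have total cyclic length at least \<open>n \<cdot> x (x + 1) / 2\<close> for \<open>x = m / n\<close>.
\<close>

text \<open>Induction on \<open>A\<close>: some element without an \<open>r\<close>-successor in
  \<open>A\<close> receives the largest number, and the rest is numbered recursively.\<close>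

lemma acyclic_imp_topological_numbering:
  assumes "finite A" "finite r" "acyclic r"
  shows "\<exists>f :: 'a \<Rightarrow> nat. inj_on f A \<and> f ` A \<subseteq> {..<card A} \<and>
           (\<forall>x\<in>A. \<forall>y\<in>A. (x, y) \<in> r \<longrightarrow> f x < f y)"
  using \<open>finite A\<close>
proof (induction A rule: finite_psubset_induct)
  case (psubset A)
  show ?case
  proof (cases "A = {}")
    case False
    have "wf (r\<inverse>)"
      using assms by (simp add: finite_acyclic_wf_converse)
    then obtain z where z: "z \<in> A" "\<And>y. (z, y) \<in> r \<Longrightarrow> y \<notin> A"
      using False by (metis wfE_min' converse_iff)
    have "A - {z} \<subset> A"
      using z(1) by blast
    from psubset.IH[OF this]
    obtain f :: "'a \<Rightarrow> nat" where f: "inj_on f (A - {z})" "f ` (A - {z}) \<subseteq> {..<card (A - {z})}"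
      "\<And>x y. x \<in> A - {z} \<Longrightarrow> y \<in> A - {z} \<Longrightarrow> (x, y) \<in> r \<Longrightarrow> f x < f y"
      by meson
    define k where "k = card (A - {z})"
    have k: "card A = Suc k"
      using card.remove[OF psubset.hyps(1) z(1)] unfolding k_def .
    have less: "f x < k" if "x \<in> A" "x \<noteq> z" for x
      using f(2) that unfolding k_def by blast
    have "inj_on (f(z := k)) A"
      using f(1) less by (fastforce simp: inj_on_def)
    moreover have "(f(z := k)) ` A \<subseteq> {..<card A}"
      using less k by (auto simp: less_Suc_eq)
    moreover have "(f(z := k)) x < (f(z := k)) y" if "x \<in> A" "y \<in> A" "(x, y) \<in> r" for x y
      using that z(2) f(3) less by auto
    ultimately show ?thesis
      by blast
  qed simp
qed

text \<open>For any \<open>K\<close>, the sum is at least \<open>K * card A\<close> minus the total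
  deficit of the values below \<open>K\<close>, and the fibre bound limits that deficit to
  \<open>n * K * (K - 1) / 2\<close>.\<close>

lemma sum_ge_of_card_fibre_le:
  fixes c :: "'a \<Rightarrow> nat"
  assumes "finite A" "n > 0"
    and pos: "\<And>a. a \<in> A \<Longrightarrow> c a > 0"
    and fibre: "\<And>d. card {a \<in> A. c a = d} \<le> n"
  shows "(real (card A))\<^sup>2 / (2 * real n) + real (card A) / 2 \<le> real (\<Sum>a\<in>A. c a)"
proof -
  define x where "x = real (card A) / real n"
  \<comment> \<open>The resulting bound \<open>2 * K * x - K * (K - 1)\<close> is concave in
    \<open>K\<close> and equals \<open>x * (x + 1)\<close> at both \<open>K = x\<close> and
    \<open>K = x + 1\<close>, so an integer between these loses nothing.\<close>
  define K where "K = nat \<lceil>x\<rceil>"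
  have "x \<ge> 0"
    by (simp add: x_def)
  then have K: "real K - 1 \<le> x" "x \<le> real K"
    unfolding K_def by linarith+
  \<comment> \<open>Truncated subtraction discards values from \<open>K\<close> on; positivity of
    \<open>c\<close> removes the fibre over \<open>0\<close>.\<close>
  have "(\<Sum>a\<in>A. K - c a) = (\<Sum>a\<in>{a \<in> A. c a < K}. K - c a)"
    using \<open>finite A\<close> by (intro sum.mono_neutral_right) auto
  also have "\<dots> = (\<Sum>d\<in>{1..<K}. \<Sum>a\<in>{a \<in> {a \<in> A. c a < K}. c a = d}. K - c a)"
    using \<open>finite A\<close> pos by (intro sum.group[symmetric]) (auto simp: Suc_le_eq)
  also have "\<dots> = (\<Sum>d\<in>{1..<K}. card {a \<in> A. c a = d} * (K - d))"
  proof (intro sum.cong refl)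
    fix d assume "d \<in> {1..<K}"
    then have "{a \<in> {a \<in> A. c a < K}. c a = d} = {a \<in> A. c a = d}"
      by auto
    then show "(\<Sum>a\<in>{a \<in> {a \<in> A. c a < K}. c a = d}. K - c a) = card {a \<in> A. c a = d} * (K - d)"
      by simp
  qed
  also have "\<dots> \<le> (\<Sum>d\<in>{1..<K}. n * (K - d))"
    by (intro sum_mono mult_right_mono fibre) simp
  also have "\<dots> = n * (\<Sum>d\<in>{1..<K}. d)"
    by (subst (2) sum.atLeastLessThan_rev) (simp add: sum_distrib_left)
  finally have upper: "real (\<Sum>a\<in>A. K - c a) \<le> real n * real (\<Sum>d\<in>{1..<K}. d)"
    by (metis of_nat_le_iff of_nat_mult)
  have gauss: "2 * real (\<Sum>d\<in>{1..<K}. d) = real K * (real K - 1)"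
    by (induction K) (auto simp: algebra_simps)
  have lower: "real K * real (card A) - real (\<Sum>a\<in>A. c a) \<le> real (\<Sum>a\<in>A. K - c a)"
  proof -
    have "(\<Sum>a\<in>A. real K - real (c a)) \<le> (\<Sum>a\<in>A. real (K - c a))"
      by (intro sum_mono) linarith
    then show ?thesis
      by (simp add: sum_subtractf mult.commute)
  qed
  have card: "real (card A) = real n * x"
    using \<open>n > 0\<close> by (simp add: x_def)
  have "real n * (2 * real K * x - real K * (real K - 1))
      = 2 * (real K * real (card A)) - 2 * (real n * real (\<Sum>d\<in>{1..<K}. d))"
    unfolding card gauss[symmetric] by (simp only: algebra_simps)
  also have "\<dots> \<le> 2 * real (\<Sum>a\<in>A. c a)"
    using upper lower by linarith
  finally have "real n * (2 * real K * x - real K * (real K - 1)) \<le> 2 * real (\<Sum>a\<in>A. c a)" .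
  moreover have "x * (x + 1) \<le> 2 * real K * x - real K * (real K - 1)"
  proof -
    have "(x - real K) * (x - real K + 1) \<le> 0"
      using K by (intro mult_nonpos_nonneg) auto
    then show ?thesis
      by (simp add: algebra_simps)
  qed
  ultimately have "real n * (x * (x + 1)) \<le> 2 * real (\<Sum>a\<in>A. c a)"
    by (meson mult_left_mono of_nat_0_le_iff order_trans)
  then show ?thesis
    using \<open>n > 0\<close> unfolding card by (simp add: field_simps power2_eq_square)
qed

text \<open>Grouped by heads, \<open>f v\<close> occurs in-degree many times; grouped by tails,
  out-degree many times.\<close>

lemma (in fin_digraph) eulerian_sum_head_eq_sum_tail:
  fixes f :: "'a \<Rightarrow> nat"
  assumes "eulerian G"
  shows "(\<Sum>e\<in>arcs G. f (head G e)) = (\<Sum>e\<in>arcs G. f (tail G e))"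
proof -
  have "(\<Sum>e\<in>arcs G. f (head G e)) = (\<Sum>v\<in>verts G. \<Sum>e\<in>in_arcs G v. f (head G e))"
    unfolding in_arcs_def by (intro sum.group[symmetric]) auto
  also have "\<dots> = (\<Sum>v\<in>verts G. in_degree G v * f v)"
    by (simp add: in_degree_def)
  also have "\<dots> = (\<Sum>v\<in>verts G. out_degree G v * f v)"
    using assms by (simp add: eulerian_def)
  also have "\<dots> = (\<Sum>v\<in>verts G. \<Sum>e\<in>out_arcs G v. f (tail G e))"
    by (simp add: out_degree_def)
  also have "\<dots> = (\<Sum>e\<in>arcs G. f (tail G e))"
    unfolding out_arcs_def by (intro sum.group) auto
  finally show ?thesis .
qed

lemma (in digraph) eulerian_card_backward_arcs_ge:
  fixes f :: "'a \<Rightarrow> nat"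
  assumes "eulerian G"
    and inj: "inj_on f (verts G)" and ran: "f ` verts G \<subseteq> {..<n}" and "n > 0"
  shows "(real (card (arcs G)))\<^sup>2 / (2 * (real n)\<^sup>2) + real (card (arcs G)) / (2 * real n)
           \<le> real (card {e \<in> arcs G. f (head G e) < f (tail G e)})"
proof -
  define B where "B = {e \<in> arcs G. f (head G e) < f (tail G e)}"
  \<comment> \<open>The cyclic length. Adding \<open>n\<close> first keeps the natural subtraction
    exact on backward arcs, as positions are below \<open>n\<close>.\<close>
  define c where "c e = (if e \<in> B then n else 0) + f (head G e) - f (tail G e)" for e
  have less: "f (tail G e) < n" "f (head G e) < n" if "e \<in> arcs G" for e
    using ran that by (simp_all add: image_subset_iff)
  have neq: "f (tail G e) \<noteq> f (head G e)" if "e \<in> arcs G" for e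
    using inj no_loops that by (metis inj_on_eq_iff head_in_verts tail_in_verts)
  have c: "c e + f (tail G e) = (if e \<in> B then n else 0) + f (head G e)" "c e > 0"
    if "e \<in> arcs G" for e
    using less[OF that] neq[OF that] that unfolding c_def B_def by auto
  have "card {e \<in> arcs G. c e = d} \<le> n" for d
  proof -
    \<comment> \<open>Tail position and cyclic length fix the head position, since two positions
      below \<open>n\<close> cannot differ by \<open>n\<close>. The ends then fix the arc.\<close>
    have "inj_on (\<lambda>e. f (tail G e)) {e \<in> arcs G. c e = d}"
    proof (intro inj_onI)
      fix e e' assume e: "e \<in> {e \<in> arcs G. c e = d}" "e' \<in> {e \<in> arcs G. c e = d}"
        and eq: "f (tail G e) = f (tail G e')"
      then have "f (head G e) = f (head G e')"
        using c(1)[of e] c(1)[of e'] less[of e] less[of e'] by (auto split: if_splits)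
      then have "arc_to_ends G e = arc_to_ends G e'"
        using e eq inj by (auto simp: arc_to_ends_def inj_on_eq_iff)
      then show "e = e'"
        using e no_multi_arcs by blast
    qed
    moreover have "(\<lambda>e. f (tail G e)) ` {e \<in> arcs G. c e = d} \<subseteq> {..<n}"
      using less by auto
    ultimately show ?thesis
      using card_inj_on_le[of _ _ "{..<n}"] by simp
  qed
  then have "(real (card (arcs G)))\<^sup>2 / (2 * real n) + real (card (arcs G)) / 2
      \<le> real (\<Sum>e\<in>arcs G. c e)"
    using \<open>n > 0\<close> c(2) by (intro sum_ge_of_card_fibre_le) auto
  moreover have "(\<Sum>e\<in>arcs G. c e) = n * card B"
  proof -
    have "(\<Sum>e\<in>arcs G. c e) + (\<Sum>e\<in>arcs G. f (tail G e))
        = (\<Sum>e\<in>arcs G. if e \<in> B then n else 0) + (\<Sum>e\<in>arcs G. f (head G e))"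
      unfolding sum.distrib[symmetric] using c(1) by (intro sum.cong) auto
    moreover have "(\<Sum>e\<in>arcs G. if e \<in> B then n else 0) = n * card B"
    proof -
      have "arcs G \<inter> B = B"
        by (auto simp: B_def)
      then show ?thesis
        by (simp add: sum.If_cases)
    qed
    ultimately show ?thesis
      using eulerian_sum_head_eq_sum_tail[OF \<open>eulerian G\<close>, of f] by simp
  qed
  ultimately show ?thesis
    using \<open>n > 0\<close> unfolding B_def by (simp add: field_simps power2_eq_square)
qed

text \<open>A nonempty closed walk contains a cycle.\<close>

lemma (in wf_digraph) no_cycle_imp_acyclic:
  assumes "\<nexists>p. cycle p"
  shows "acyclic (arcs_ends G)"
proof (rule acyclicI, intro allI notI)
  fix u assume "u \<rightarrow>\<^sup>+ u"
  then obtain p where "awalk u p u" "p \<noteq> []"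
    unfolding reachable1_awalk by blast
  then have "closed_w p"
    unfolding closed_w_def by auto
  with assms show False
    using closed_w_imp_cycle by blast
qed

lemma (in fin_digraph) feedback_arc_set_contains_backward_arcs:
  assumes "feedback_arc_set G F"
  shows "\<exists>f :: 'a \<Rightarrow> nat. inj_on f (verts G) \<and> f ` verts G \<subseteq> {..<card (verts G)} \<and>
           {e \<in> arcs G. f (head G e) < f (tail G e)} \<subseteq> F"
proof -
  interpret D: wf_digraph "del_arcs G F"
    by unfold_locales (auto simp: del_arcs_def)
  have "acyclic (arcs_ends (del_arcs G F))"
    using assms by (intro D.no_cycle_imp_acyclic) (simp add: feedback_arc_set_def)
  moreover have ends: "arcs_ends (del_arcs G F) = (\<lambda>e. (tail G e, head G e)) ` (arcs G - F)"
    by (simp add: arcs_ends_def arc_to_ends_def del_arcs_def)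
  ultimately obtain f :: "'a \<Rightarrow> nat" where f:
    "inj_on f (verts G)" "f ` verts G \<subseteq> {..<card (verts G)}"
    "\<And>x y. x \<in> verts G \<Longrightarrow> y \<in> verts G \<Longrightarrow> (x, y) \<in> arcs_ends (del_arcs G F) \<Longrightarrow> f x < f y"
    using acyclic_imp_topological_numbering[of "verts G" "arcs_ends (del_arcs G F)"] by auto
  \<comment> \<open>A backward arc outside \<open>F\<close> would survive the deletion and hence go
    forward.\<close>
  have "e \<in> F" if "e \<in> arcs G" "f (head G e) < f (tail G e)" for e
    using f(3)[of "tail G e" "head G e"] that unfolding ends by fastforce
  with f(1,2) show ?thesis
    by blast
qed

lemma (in fin_digraph) min_feedback_attained:
  "\<exists>F. feedback_arc_set G F \<and> \<beta> G = card F"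
proof -
  \<comment> \<open>Without arcs only empty walks remain, and these are not cycles; so the minimum
    ranges over a nonempty set.\<close>
  have "feedback_arc_set G (arcs G)"
    by (auto simp: feedback_arc_set_def del_arcs_def pre_digraph.cycle_def pre_digraph.awalk_def)
  moreover have "finite {F. feedback_arc_set G F}"
    by (rule finite_subset[of _ "Pow (arcs G)"]) (auto simp: feedback_arc_set_def)
  ultimately have "\<beta> G \<in> card ` {F. feedback_arc_set G F}"
    unfolding min_feedback_def by (intro Min_in) auto
  then show ?thesis
    by blast
qed

theorem theorem1p1:
  fixes G :: "('a, 'b) pre_digraph" and n m :: nat
  assumes "digraph G"
    and "eulerian G"
    and "n = card (verts G)"
    and "m = card (arcs G)"
  shows "real (\<beta> G) \<ge> (real m)\<^sup>2 / (2 * (real n)\<^sup>2) + real m / (2 * real n)"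
proof (cases "n = 0")
  case False
  interpret digraph G
    by fact
  obtain F where F: "feedback_arc_set G F" "\<beta> G = card F"
    using min_feedback_attained by blast
  obtain f :: "'a \<Rightarrow> nat" where f: "inj_on f (verts G)" "f ` verts G \<subseteq> {..<n}"
    "{e \<in> arcs G. f (head G e) < f (tail G e)} \<subseteq> F"
    using feedback_arc_set_contains_backward_arcs[OF F(1)] assms(3) by blast
  have "finite F"
    using F(1) finite_subset[OF _ finite_arcs] unfolding feedback_arc_set_def by simp
  then have "card {e \<in> arcs G. f (head G e) < f (tail G e)} \<le> \<beta> G"
    using card_mono[OF _ f(3)] F(2) by simp
  then show ?thesis
    using eulerian_card_backward_arcs_ge[OF assms(2) f(1,2)] False assms(4) by simp
\<comment> \<open>For \<open>n = 0\<close> both fractions are \<open>0\<close>, the value of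
  division by zero.\<close>
qed simp

end
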